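(* Let $\phi:\mathbb{R}^q\to\mathbb{R}^q$ act componentwise and satisfy $|\phi(r)-\phi(s)|\le|r-s|$ for all $r,s$ (componentwise). Let $W\in\mathbb{R}^{q\times q}$, $U\in\mathbb{R}^{q\times p}$, $V\in\mathbb{R}^{m\times q}$, $K\in\mathbb{R}^{m\times p}$, $b\in\mathbb{R}^q$, $d\in\mathbb{R}^m$ with $\lambda_{\mathrm{pf}}(|W|)<1$. Fix a measurement $y\in\mathbb{R}^p$, let $\eta$ solve $\eta=\phi(W\eta+Uy+b)$, and set $u=Ky+V\eta+d$. Let $D_\phi=\mathrm{diag}(\delta_i)$, where $\delta_i=\phi_i'\big((W\eta+Uy+b)_i\big)$ at differentiability points, and where at ReLU kink points $\delta_i$ may be any element of $[0,1]$ (a generalized derivative of the activation). Then $I-D_\phi W$ is nonsingular and $$\frac{\partial\eta}{\partial y}=(I-D_\phi W)^{-1}D_\phi U,\qquad\frac{\partial u}{\partial y}=K+V(I-D_\phi W)^{-1}D_\phi U.$$ Moreover, for a differentiable scalar loss $\ell(u)$, let $g=\nabla_u\ell\in\mathbb{R}^m$. Then the adjoint fixed-point equation $$v=D_\phi(W^\top v+V^\top g)$$ has a unique solution $v\in\mathbb{R}^q$, and the gradients of the loss, viewed as a function of $y$ and of the parameters through $u$, are $$\nabla_y\ell=K^\top g+U^\top v,\quad\nabla_W\ell=v\eta^\top,\quad\nabla_U\ell=vy^\top,\quad\nabla_b\ell=v,$$ $$\nabla_V\ell=g\eta^\top,\quad\nabla_K\ell=gy^\top,\quad\nabla_d\ell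=g.$$
   Context: For a matrix $M$, $|M|$ is the componentwise absolute value; for a nonnegative square matrix, $\lambda_{\mathrm{pf}}$ is its Perron--Frobenius eigenvalue (spectral radius). "Acts componentwise" means $\phi(r)_i=\phi_i(r_i)$ for scalar functions $\phi_i$. Under these hypotheses the equation $\eta=\phi(W\eta+Uy+b)$ has a unique solution for every $y$ (and for nearby parameters), so $\eta$ and $u$ are functions of $y$ and of $(W,U,V,K,b,d)$. When each $\phi_i$ is differentiable at $(W\eta+Uy+b)_i$, the derivatives are ordinary derivatives. A ReLU kink point is a component $i$ with $\phi_i(r)=\max\{0,r\}$ and $(W\eta+Uy+b)_i=0$; there the displayed Jacobians and gradients are understood as the generalized sensitivities obtained by replacing $\phi_i'$ by the chosen $\delta_i\in[0,1]$ in implicit differentiation. Gradients with respect to matrices are with respect to the Frobenius inner product. *)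

theory Defs
  imports "HOL-Analysis.Analysis"
begin

definition complex_eigenvalues :: "real^'n^'n \<Rightarrow> complex set" where
  "complex_eigenvalues A =
     {z. \<exists>x. x \<noteq> 0 \<and> map_matrix complex_of_real A *v x = z *s x}"

text \<open>The spectral radius; for an entrywise nonnegative matrix this is its
  Perron--Frobenius eigenvalue.\<close>

definition lambda_pf :: "real^'n^'n \<Rightarrow> real" where
  "lambda_pf A = Max (cmod ` complex_eigenvalues A)"

definition diag :: "real^'n \<Rightarrow> real^'n^'n" where
  "diag \<delta> = (\<chi> i j. if i = j then \<delta> $ i else 0)"

definition outer :: "real^'m \<Rightarrow> real^'n \<Rightarrow> real^'n^'m" where
  "outer v w = (\<chi> i j. v $ i * w $ j)"

definition equilibrium ::
  "(real^'q \<Rightarrow> real^'q) \<Rightarrow> real^'q^'q \<Rightarrow> real^'p^'q \<Rightarrow> real^'q \<Rightarrow> real^'p \<Rightarrow> real^'q" where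
  "equilibrium \<phi> W U b y = (THE x. x = \<phi> (W *v x + U *v y + b))"

definition control ::
  "(real^'q \<Rightarrow> real^'q) \<Rightarrow> real^'q^'q \<Rightarrow> real^'p^'q \<Rightarrow> real^'q^'m \<Rightarrow> real^'p^'m
    \<Rightarrow> real^'q \<Rightarrow> real^'m \<Rightarrow> real^'p \<Rightarrow> real^'m" where
  "control \<phi> W U V K b d y = K *v y + V *v equilibrium \<phi> W U b y + d"

text \<open>Generalized sensitivities. A parameter \<open>t\<close> enters an equilibrium equation
  \<open>x = \<phi> (Z t x)\<close> and an output \<open>R t x\<close>. Implicit differentiation at \<open>(t, x)\<close>, with
  the derivative of the componentwise map \<open>\<phi>\<close> replaced by \<open>diag \<delta>\<close>, requires of the
  sensitivity \<open>L\<close> of the equilibrium that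
  \<open>L h = diag \<delta> *v (\<partial>\<^sub>t Z h + \<partial>\<^sub>x Z (L h))\<close> in every direction \<open>h\<close>. The sensitivity
  of the output and the gradient of a loss then follow from the chain rule.\<close>

definition implicit_derivative ::
  "real^'q \<Rightarrow> ('a::real_normed_vector \<Rightarrow> real^'q \<Rightarrow> real^'q) \<Rightarrow> 'a \<Rightarrow> real^'q
    \<Rightarrow> ('a \<Rightarrow> real^'q) \<Rightarrow> bool" where
  "implicit_derivative \<delta> Z t x L \<longleftrightarrow>
     bounded_linear L \<and>
     (\<exists>Z'. ((\<lambda>(s, r). Z s r) has_derivative Z') (at (t, x)) \<and>
           (\<forall>h. L h = diag \<delta> *v Z' (h, L h)))"

definition implicit_output_derivative ::
  "real^'q \<Rightarrow> ('a::real_normed_vector \<Rightarrow> real^'q \<Rightarrow> real^'q) \<Rightarrow> ('a \<Rightarrow> real^'q \<Rightarrow> real^'m)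
    \<Rightarrow> 'a \<Rightarrow> real^'q \<Rightarrow> ('a \<Rightarrow> real^'m) \<Rightarrow> bool" where
  "implicit_output_derivative \<delta> Z R t x M \<longleftrightarrow>
     (\<exists>L R'. implicit_derivative \<delta> Z t x L \<and>
             ((\<lambda>(s, r). R s r) has_derivative R') (at (t, x)) \<and>
             (\<forall>h. M h = R' (h, L h)))"

definition implicit_gradient ::
  "real^'q \<Rightarrow> ('a::real_inner \<Rightarrow> real^'q \<Rightarrow> real^'q) \<Rightarrow> ('a \<Rightarrow> real^'q \<Rightarrow> real^'m)
    \<Rightarrow> (real^'m \<Rightarrow> real) \<Rightarrow> 'a \<Rightarrow> real^'q \<Rightarrow> 'a \<Rightarrow> bool" where
  "implicit_gradient \<delta> Z R \<l> t x G \<longleftrightarrow>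
     (\<exists>M \<l>'. implicit_output_derivative \<delta> Z R t x M \<and>
             (\<l> has_derivative \<l>') (at (R t x)) \<and>
             (\<forall>h. \<l>' (M h) = h \<bullet> G))"

end

theory Submission
  imports Defs "HOL-Computational_Algebra.Polynomial"
begin

text \<open>Since \<open>\<lambda>\<^sub>p\<^sub>f |W| < 1\<close>, there are weights \<open>w \<ge> 1\<close> with \<open>|W| w = w - 1\<close>, so that for \<open>W'\<close> near
  \<open>W\<close> the map \<open>x \<mapsto> \<phi> (W' x + a)\<close> is a contraction in the weighted maximum norm, with one rate
  \<open>c < 1\<close> for all of them. The same estimate applied to \<open>x \<mapsto> diag \<delta> W x\<close> makes
  \<open>I - diag \<delta> W\<close> nonsingular. For a contraction the residual of a point bounds its distance to the
  fixed point; applied to the linear prediction from implicit differentiation, this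
  shows that the equilibrium is differentiable. The gradients follow from the adjoint identity
  \<open>V\<^sup>T g \<bullet> k = v \<bullet> a\<close> for a solution \<open>k\<close> of the linearized equation \<open>k = diag \<delta> (a + W k)\<close>.\<close>

section \<open>Weights from the spectral radius\<close>

text \<open>\<open>Max\<close> in \<open>lambda_pf\<close> bounds the moduli of the eigenvalues only
  once their set is known to be finite.\<close>

lemma finite_complex_eigenvalues: "finite (complex_eigenvalues A)"
  for A :: "real^'n^'n"
proof -
  define B where "B = map_matrix complex_of_real A"
  \<comment> \<open>The reversed characteristic polynomial \<open>det (I - z B)\<close>. Its value 1
    at 0 shows at once that it is not zero; its roots are the inverses of the nonzero eigenvalues,
    so the eigenvalue 0 is treated apart.\<close>
  define p :: "complex poly" where
    "p = det (\<chi> i j. [: if i = j then 1 else 0, - B $ i $ j :])"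
  have p: "poly p z = det (\<chi> i j. (if i = j then 1 else 0) - z * B $ i $ j)" for z
    by (simp add: p_def det_def poly_sum poly_prod)
  have "poly p 0 = 1"
    using det_I[where 'n='n and 'a=complex] by (simp add: p mat_def)
  then have "p \<noteq> 0" by auto
  have "z = 0 \<or> poly p (1 / z) = 0" if "z \<in> complex_eigenvalues A" for z
  proof (rule disjCI)
    assume "poly p (1 / z) \<noteq> 0"
    let ?M = "(\<chi> i j. (if i = j then 1 else 0) - 1 / z * B $ i $ j) :: complex^'n^'n"
    from that obtain x where x: "x \<noteq> 0" "B *v x = z *s x"
      by (auto simp: complex_eigenvalues_def B_def)
    have "invertible ?M"
      using \<open>poly p (1 / z) \<noteq> 0\<close> by (simp add: p invertible_det_nz)
    then have "?M *v x \<noteq> 0"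
      using x(1) unfolding invertible_left_inverse matrix_left_invertible_ker by blast
    moreover have "?M *v x = 0" if "z \<noteq> 0"
    proof -
      have "(?M *v x) $ i = x $ i - 1 / z * (B *v x) $ i" for i
        by (simp add: matrix_vector_mult_def left_diff_distrib sum_subtractf sum_distrib_left
            if_distrib[where f="\<lambda>c. c * _"] sum.delta cong: if_cong)
      then show ?thesis
        using that by (simp add: vec_eq_iff x(2))
    qed
    ultimately show "z = 0" by blast
  qed
  then have "complex_eigenvalues A \<subseteq> insert 0 ((\<lambda>w. 1 / w) ` {w. poly p w = 0})"
    by force
  moreover have "finite {w. poly p w = 0}"
    using \<open>p \<noteq> 0\<close> by (rule poly_roots_finite)
  ultimately show ?thesis
    by (meson finite_imageI finite_insert finite_subset)
qed

text \<open>A nonzero kernel vector \<open>x\<close> satisfies \<open>x = t A x\<close>, which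
  forces \<open>t > 0\<close> and makes \<open>1 / t\<close> an eigenvalue of modulus at least 1.
  Real vectors are embedded in the complex ones to meet the definition of the spectrum.\<close>

lemma det_ne_0_of_lambda_pf_less_1:
  fixes A :: "real^'n^'n"
  assumes "lambda_pf A < 1" "t \<in> {0..1}"
  shows "det (mat 1 - t *\<^sub>R A) \<noteq> 0"
proof
  assume "det (mat 1 - t *\<^sub>R A) = 0"
  then have "\<not> invertible (mat 1 - t *\<^sub>R A)"
    by (simp add: invertible_det_nz)
  then obtain x where x: "(mat 1 - t *\<^sub>R A) *v x = 0" "x \<noteq> 0"
    unfolding invertible_left_inverse matrix_left_invertible_ker by blast
  then have eq: "x = t *\<^sub>R (A *v x)"
    by (simp add: matrix_vector_mult_diff_rdistrib scaleR_matrix_vector_assoc)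
  then have t: "t > 0"
    using x(2) assms(2) by (metis atLeastAtMost_iff less_eq_real_def scaleR_eq_0_iff)
  define z where "z = (\<chi> i. complex_of_real (x $ i))"
  have "(map_matrix complex_of_real A *v z) $ i = complex_of_real ((A *v x) $ i)" for i
    by (simp add: z_def matrix_vector_mult_def)
  moreover have "(A *v x) $ i = x $ i / t" for i
    using arg_cong[OF eq, of "\<lambda>v. v $ i"] t by (simp add: field_simps)
  ultimately have "map_matrix complex_of_real A *v z = complex_of_real (1 / t) *s z"
    by (simp add: vec_eq_iff z_def)
  moreover have "z \<noteq> 0"
    using x(2) by (auto simp: vec_eq_iff z_def)
  ultimately have "complex_of_real (1 / t) \<in> complex_eigenvalues A"
    unfolding complex_eigenvalues_def by blast
  then have "cmod (complex_of_real (1 / t)) \<le> lambda_pf A"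
    unfolding lambda_pf_def by (intro Max_ge finite_imageI finite_complex_eigenvalues imageI)
  then have "1 / t \<le> lambda_pf A"
    using t by (simp only: norm_of_real)
  moreover have "1 \<le> 1 / t"
    using t assms(2) by simp
  ultimately show False
    using assms(1) by linarith
qed

lemma continuous_on_det:
  fixes M :: "'a::topological_space \<Rightarrow> real^'n^'n"
  assumes "continuous_on S M"
  shows "continuous_on S (\<lambda>x. det (M x))"
  unfolding det_def using assms by (intro continuous_intros)

text \<open>Along the segment \<open>t A\<close>, \<open>0 \<le> t \<le> 1\<close>, the solution \<open>x\<close> of \<open>x = 1 + t A x\<close> depends
  continuously on \<open>t\<close>, and once \<open>x\<close> is positive it is even bounded below by \<open>1\<close>. Positivity is
  therefore an open and closed condition on \<open>t\<close>, and it holds at \<open>t = 0\<close>.\<close>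

lemma lambda_pf_less_1_imp_weights:
  fixes A :: "real^'n^'n"
  assumes pf: "lambda_pf A < 1" and nonneg: "\<And>i j. 0 \<le> A $ i $ j"
  obtains w where "\<And>i. 1 \<le> w $ i" "\<And>i. (A *v w) $ i = w $ i - 1"
proof -
  define M where "M t = mat 1 - t *\<^sub>R A" for t
  \<comment> \<open>Cramer's rule for \<open>M t *v x = 1\<close>. As a quotient of determinants the
    solution is visibly continuous in \<open>t\<close>.\<close>
  define x where
    "x t = (\<chi> k. det (\<chi> i j. if j = k then 1 else M t $ i $ j) / det (M t))" for t
  have det: "det (M t) \<noteq> 0" if "t \<in> {0..1}" for t
    unfolding M_def using pf that by (rule det_ne_0_of_lambda_pf_less_1)
  have contM: "continuous_on {0..1} M"
    unfolding M_def by (intro continuous_intros)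
  have contx: "continuous_on {0..1} (\<lambda>t. x t $ k)" for k
    unfolding x_def vec_lambda_beta
  proof (intro continuous_on_divide continuous_on_det contM ballI det)
    have "continuous_on {0..1} (\<lambda>t. if j = k then 1 else M t $ i $ j)" for i j
      by (cases "j = k") (auto intro!: continuous_intros contM)
    then show "continuous_on {0..1} (\<lambda>t. \<chi> i j. if j = k then 1 else M t $ i $ j)"
      by (intro continuous_on_vec_lambda)
  qed
  have x: "x t $ i = 1 + t * (A *v x t) $ i" if "t \<in> {0..1}" for t i
  proof -
    have "M t *v x t = (\<chi> i. 1)"
      using cramer[OF det[OF that], of "x t" "\<chi> i. 1"] by (simp add: x_def cong: if_cong)
    then have "x t - t *\<^sub>R (A *v x t) = (\<chi> i. 1)"
      by (simp add: M_def matrix_vector_mult_diff_rdistrib scaleR_matrix_vector_assoc)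
    then show ?thesis
      by (simp add: vec_eq_iff algebra_simps)
  qed
  define P where "P = {t \<in> {0..1}. \<forall>i. 0 < x t $ i}"
  have ge1: "1 \<le> x t $ i" if "t \<in> P" for t i
  proof -
    have "0 \<le> (A *v x t) $ i"
      using that nonneg unfolding P_def matrix_vector_mult_def
      by (auto intro!: sum_nonneg mult_nonneg_nonneg simp: less_imp_le)
    then show ?thesis
      using x[of t i] that by (simp add: P_def)
  qed
  have "P = (\<Inter>i. {0..1} \<inter> (\<lambda>t. x t $ i) -` {0<..})"
    by (auto simp: P_def)
  moreover have "openin (top_of_set {0..1}) ..."
    by (intro openin_INT2 continuous_openin_preimage_gen contx) auto
  ultimately have openP: "openin (top_of_set {0..1}) P" by simp
  have "P = (\<Inter>i. {0..1} \<inter> (\<lambda>t. x t $ i) -` {1..})"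
    using ge1 by (force simp: P_def intro: less_le_trans[OF zero_less_one])
  moreover have "closedin (top_of_set {0..1}) ..."
    by (intro closedin_INT continuous_closedin_preimage contx) auto
  ultimately have "closedin (top_of_set {0..1}) P" by simp
  moreover have "0 \<in> P"
    using x[of 0] by (simp add: P_def)
  ultimately have "P = {0..1}"
    using openP connected_Icc[of 0 "1::real"] unfolding connected_clopen by blast
  then have "1 \<in> P" by simp
  then show thesis
    using ge1[of 1] x[of 1] by (intro that[of "x 1"]) auto
qed

section \<open>Weighted contractions\<close>

text \<open>For positive \<open>w\<close> this is the Lipschitz condition with constant
  \<open>c\<close> in the norm \<open>max_i |x_i| / w_i\<close>. Quantifying over every bound
  \<open>M\<close> of the weighted distance avoids introducing that norm.\<close>

definition weighted_contraction :: "real^'n \<Rightarrow> real \<Rightarrow> (real^'n \<Rightarrow> real^'n) \<Rightarrow> bool" where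
  "weighted_contraction w c F \<longleftrightarrow>
     (\<forall>x z M. (\<forall>i. \<bar>x $ i - z $ i\<bar> \<le> M * w $ i) \<longrightarrow> (\<forall>i. \<bar>F x $ i - F z $ i\<bar> \<le> c * (M * w $ i)))"

lemma weighted_contractionD:
  "\<lbrakk>weighted_contraction w c F; \<And>j. \<bar>x $ j - z $ j\<bar> \<le> M * w $ j\<rbrakk>
     \<Longrightarrow> \<bar>F x $ i - F z $ i\<bar> \<le> c * (M * w $ i)"
  unfolding weighted_contraction_def by blast

text \<open>Row by row, \<open>|W (x - z)| \<le> |W| |x - z| \<le> M |W| w \<le> c M w\<close>, and
  \<open>\<phi>\<close> does not enlarge differences.\<close>

lemma weighted_contraction_nonexpansive_affine:
  assumes nonexpansive: "\<And>r s. \<bar>\<phi> r - \<phi> s\<bar> \<le> \<bar>r - s\<bar>"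
    and W: "\<And>i. (\<bar>W\<bar> *v w) $ i \<le> c * w $ i"
    and w: "\<And>i. 0 < w $ i"
  shows "weighted_contraction w c (\<lambda>x. \<phi> (W *v x + a))"
  unfolding weighted_contraction_def
proof (intro allI impI)
  fix x z and M i
  assume M: "\<forall>i. \<bar>x $ i - z $ i\<bar> \<le> M * w $ i"
  \<comment> \<open>The sign of \<open>M\<close>, required for multiplying the bound on
    \<open>|W| w\<close> by it, comes from \<open>M * w $ i\<close> dominating an absolute
    value.\<close>
  have "0 \<le> M * w $ i"
    using M abs_ge_zero order_trans by blast
  then have "0 \<le> M"
    using w[of i] by (simp add: zero_le_mult_iff)
  have "\<bar>\<phi> (W *v x + a) $ i - \<phi> (W *v z + a) $ i\<bar> \<le> \<bar>(W *v x + a) $ i - (W *v z + a) $ i\<bar>"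
    using nonexpansive[of "W *v x + a" "W *v z + a"] by (simp add: less_eq_vec_def abs_vec_def)
  also have "\<dots> = \<bar>\<Sum>j\<in>UNIV. W $ i $ j * (x $ j - z $ j)\<bar>"
    by (simp add: matrix_vector_mult_def right_diff_distrib sum_subtractf)
  also have "\<dots> \<le> (\<Sum>j\<in>UNIV. \<bar>W $ i $ j * (x $ j - z $ j)\<bar>)"
    by (rule sum_abs)
  also have "\<dots> \<le> (\<Sum>j\<in>UNIV. \<bar>W $ i $ j\<bar> * (M * w $ j))"
    using M by (intro sum_mono) (simp add: abs_mult mult_left_mono)
  also have "\<dots> = M * (\<bar>W\<bar> *v w) $ i"
    by (simp add: matrix_vector_mult_def abs_vec_def sum_distrib_left mult_ac)
  also have "\<dots> \<le> M * (c * w $ i)"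
    using \<open>0 \<le> M\<close> W by (intro mult_left_mono) auto
  finally show "\<bar>\<phi> (W *v x + a) $ i - \<phi> (W *v z + a) $ i\<bar> \<le> c * (M * w $ i)"
    by (simp add: mult_ac)
qed

text \<open>At the component \<open>k\<close> of largest weighted error \<open>M\<close>, the
  triangle inequality gives \<open>M \<le> norm (z - F z) + c * M\<close>, and the last term is
  absorbed on the left. The sum of the weights converts the weighted bound back to the Euclidean
  norm.\<close>

lemma weighted_contraction_fixed_point_error:
  assumes F: "weighted_contraction w c F" and c: "c < 1" and w: "\<And>i. 1 \<le> w $ i"
    and x: "x = F x"
  shows "norm (z - x) \<le> (\<Sum>i\<in>UNIV. w $ i) / (1 - c) * norm (z - F z)"
proof -
  define f where "f i = \<bar>z $ i - x $ i\<bar> / w $ i" for i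
  define M where "M = Max (range f)"
  have "M \<in> range f" unfolding M_def by (intro Max_in) auto
  then obtain k where k: "M = f k" by blast
  have w0: "0 < w $ i" for i using w[of i] by simp
  have M: "\<bar>z $ i - x $ i\<bar> \<le> M * w $ i" for i
  proof -
    have "f i \<le> M" unfolding M_def by (intro Max_ge) auto
    then show ?thesis using w0[of i] by (simp add: f_def pos_divide_le_eq)
  qed
  have "M * w $ k = \<bar>z $ k - x $ k\<bar>"
    using w0[of k] by (simp add: k f_def)
  also have "\<dots> \<le> \<bar>(z - F z) $ k\<bar> + \<bar>F z $ k - F x $ k\<bar>"
    using x by simp
  also have "\<dots> \<le> norm (z - F z) * w $ k + c * (M * w $ k)"
  proof (rule add_mono)
    have "\<bar>(z - F z) $ k\<bar> \<le> norm (z - F z) * 1"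
      using component_le_norm_cart[of "z - F z" k] by simp
    also have "\<dots> \<le> norm (z - F z) * w $ k"
      using w by (intro mult_left_mono) auto
    finally show "\<bar>(z - F z) $ k\<bar> \<le> norm (z - F z) * w $ k" .
  qed (rule weighted_contractionD[OF F M])
  finally have "M * w $ k \<le> (norm (z - F z) + c * M) * w $ k"
    by (simp add: algebra_simps)
  then have "M \<le> norm (z - F z) + c * M"
    using w0[of k] by simp
  then have "M \<le> norm (z - F z) / (1 - c)"
    using c by (simp add: field_simps)
  then have "M * (\<Sum>i\<in>UNIV. w $ i) \<le> norm (z - F z) / (1 - c) * (\<Sum>i\<in>UNIV. w $ i)"
    using w0 by (intro mult_right_mono sum_nonneg) (auto intro: less_imp_le)
  moreover have "norm (z - x) \<le> M * (\<Sum>i\<in>UNIV. w $ i)"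
    unfolding sum_distrib_left using M
    by (intro order_trans[OF norm_le_l1_cart] sum_mono) auto
  ultimately show ?thesis by (simp add: mult.commute)
qed

text \<open>Brouwer's theorem on a weighted box saves setting up the weighted maximum norm as a
  metric for Banach's theorem.\<close>

lemma weighted_contraction_ex1_fixed_point:
  assumes F: "weighted_contraction w c F" and c: "c < 1" and w: "\<And>i. 1 \<le> w $ i"
  shows "\<exists>!x. x = F x"
proof -
  \<comment> \<open>With this radius \<open>|F 0| \<le> (1 - c) R w\<close>, which together with
    \<open>|F x - F 0| \<le> c R w\<close> keeps \<open>F x\<close> in the box of half-widths
    \<open>R w\<close>.\<close>
  define R where "R = norm (F 0) / (1 - c)"
  have "0 \<le> R" using c by (simp add: R_def)
  have w0: "0 \<le> w $ i" for i using w[of i] by simp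
  have bound: "a \<le> a * w $ i" if "0 \<le> a" for a i
    using mult_left_mono[OF w that, of i] by simp
  have "continuous_on S F" for S
  proof (intro lipschitz_on_continuous_on lipschitz_onI)
    fix x z
    have "\<bar>x $ i - z $ i\<bar> \<le> norm (x - z) * w $ i" for i
      using component_le_norm_cart[of "x - z" i] bound[of "norm (x - z)" i] by simp
    then have "\<bar>F x $ i - F z $ i\<bar> \<le> c * (norm (x - z) * w $ i)" for i
      by (rule weighted_contractionD[OF F])
    \<comment> \<open>The sign of \<open>c\<close> is not known at this point; bounding it by 1
      yields a nonnegative Lipschitz constant.\<close>
    also have "c * (norm (x - z) * w $ i) \<le> 1 * (norm (x - z) * w $ i)" for i
      using c w0 by (intro mult_right_mono) auto
    finally have "norm (F x - F z) \<le> (\<Sum>i\<in>UNIV. norm (x - z) * w $ i)"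
      by (intro order_trans[OF norm_le_l1_cart] sum_mono) simp
    then show "dist (F x) (F z) \<le> (\<Sum>i\<in>UNIV. w $ i) * dist x z"
      by (simp add: dist_norm sum_distrib_right mult.commute)
  qed (use w0 in \<open>auto intro: sum_nonneg\<close>)
  moreover have "F \<in> cbox (- (R *\<^sub>R w)) (R *\<^sub>R w) \<rightarrow> cbox (- (R *\<^sub>R w)) (R *\<^sub>R w)"
  proof
    fix x assume "x \<in> cbox (- (R *\<^sub>R w)) (R *\<^sub>R w)"
    then have "\<bar>x $ i - 0 $ i\<bar> \<le> R * w $ i" for i
      by (auto simp: mem_box_cart abs_le_iff minus_le_iff)
    then have FR: "\<bar>F x $ i - F 0 $ i\<bar> \<le> c * (R * w $ i)" for i
      by (rule weighted_contractionD[OF F])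
    have "\<bar>F x $ i\<bar> \<le> R * w $ i" for i
    proof -
      have "\<bar>F 0 $ i\<bar> \<le> (1 - c) * R * w $ i"
        using component_le_norm_cart[of "F 0" i] bound[of "norm (F 0)" i] c by (simp add: R_def)
      then have "\<bar>F 0 $ i\<bar> \<le> R * w $ i - c * (R * w $ i)"
        by (simp add: algebra_simps)
      then show ?thesis
        using FR[of i] by linarith
    qed
    then show "F x \<in> cbox (- (R *\<^sub>R w)) (R *\<^sub>R w)"
      by (auto simp: mem_box_cart abs_le_iff minus_le_iff)
  qed
  moreover have "0 \<in> cbox (- (R *\<^sub>R w)) (R *\<^sub>R w)"
    using \<open>0 \<le> R\<close> w0 by (simp add: mem_box_cart)
  ultimately obtain x where "F x = x"
    using brouwer[of "cbox (- (R *\<^sub>R w)) (R *\<^sub>R w)" F]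
    by (metis compact_cbox convex_box(1) empty_iff)
  moreover have "z = x" if "z = F z" for z
  proof -
    have "norm (z - x) \<le> (\<Sum>i\<in>UNIV. w $ i) / (1 - c) * norm (z - F z)"
      using \<open>F x = x\<close> by (intro weighted_contraction_fixed_point_error[OF F c w]) simp
    then show ?thesis
      using that by simp
  qed
  ultimately show ?thesis
    by metis
qed

text \<open>\<open>L h = F' (h, L h)\<close> makes the first-order terms of the residual
  \<open>\<rho>\<close> cancel, so \<open>\<rho> s\<close> is \<open>o(|s - t|)\<close>. As
  \<open>c\<close> is the same for all \<open>s\<close> near \<open>t\<close>, one constant
  \<open>C\<close> transfers this to the distance between \<open>H s\<close> and its linear
  prediction.\<close>

lemma fixed_point_has_derivative:
  assumes c: "c < 1" and w: "\<And>i. 1 \<le> w $ i"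
    and F: "\<forall>\<^sub>F s in nhds t. weighted_contraction w c (F s) \<and> H s = F s (H s)"
    and F': "((\<lambda>(s, r). F s r) has_derivative F') (at (t, H t))"
    and L: "bounded_linear L" "\<And>h. L h = F' (h, L h)"
  shows "(H has_derivative L) (at t)"
proof -
  define \<rho> where "\<rho> s = (H t + L (s - t)) - F s (H t + L (s - t))" for s
  define C where "C = (\<Sum>i\<in>UNIV. w $ i) / (1 - c)"
  have "0 < (\<Sum>i\<in>UNIV. w $ i)"
    using w by (intro sum_pos) (auto intro: less_le_trans[OF zero_less_one])
  then have "0 < C"
    using c by (simp add: C_def)
  have L0: "L 0 = 0"
    using L(1) by (rule linear_0[OF bounded_linear.linear])
  have z: "((\<lambda>s. H t + L (s - t)) has_derivative L) (at t)"
    using L(1) by (auto intro!: derivative_eq_intros bounded_linear.has_derivative[OF L(1)])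
  have "((\<lambda>s. (\<lambda>(s, r). F s r) (s, H t + L (s - t))) has_derivative (\<lambda>h. F' (h, L h))) (at t)"
    using has_derivative_compose[OF has_derivative_Pair[OF has_derivative_ident z], of "\<lambda>(s, r). F s r" F'] F'
    by (simp add: L0)
  from has_derivative_diff[OF z this] have "(\<rho> has_derivative (\<lambda>h. 0)) (at t)"
    by (simp add: \<rho>_def[abs_def] flip: L(2))
  \<comment> \<open>The filter \<open>nhds t\<close> includes the point \<open>t\<close> itself, so
    the fixed-point equation holds there too.\<close>
  moreover have "\<rho> t = 0"
    using eventually_nhds_x_imp_x[OF F] by (simp add: \<rho>_def L0)
  ultimately have \<rho>: "\<forall>\<^sub>F s in at t. norm (\<rho> s) \<le> e * norm (s - t)" if "0 < e" for e
    using that by (simp add: has_derivative_within_alt2)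
  show ?thesis
    unfolding has_derivative_within_alt2
  proof (intro conjI allI impI L(1))
    fix e :: real assume "0 < e"
    then have "\<forall>\<^sub>F s in at t. norm (\<rho> s) \<le> e / C * norm (s - t)"
      using \<open>0 < C\<close> by (intro \<rho>) simp
    moreover have "\<forall>\<^sub>F s in at t. weighted_contraction w c (F s) \<and> H s = F s (H s)"
      using F by (rule eventually_nhds_conv_at[THEN iffD1, THEN conjunct1])
    ultimately show "\<forall>\<^sub>F s in at t. norm (H s - H t - L (s - t)) \<le> e * norm (s - t)"
    proof eventually_elim
      case (elim s)
      have "norm (H s - H t - L (s - t)) = norm ((H t + L (s - t)) - H s)"
        by (metis diff_diff_eq norm_minus_commute)
      also have "\<dots> \<le> C * norm (\<rho> s)"
        unfolding C_def \<rho>_def using elim c w by (intro weighted_contraction_fixed_point_error) auto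
      also have "\<dots> \<le> C * (e / C * norm (s - t))"
        using elim \<open>0 < C\<close> by (intro mult_left_mono) auto
      finally show ?case
        using \<open>0 < C\<close> by simp
    qed
  qed
qed

section \<open>Implicit differentiation\<close>

text \<open>Where \<open>\<phi>\<close> has the true derivative \<open>diag \<delta>\<close>, the
  chain rule turns the formal equation for \<open>L\<close> into the one required of a fixed-point
  derivative. The parameter type is arbitrary, so that \<open>y\<close>, the matrices and the biases
  are served alike.\<close>

lemma implicit_derivative_imp_has_derivative:
  assumes L: "implicit_derivative \<delta> Z t x L"
    and c: "c < 1" and w: "\<And>i. 1 \<le> w $ i"
    and x: "H t = x"
    and \<phi>: "(\<phi> has_derivative (*v) (diag \<delta>)) (at (Z t x))"
    and F: "\<forall>\<^sub>F s in nhds t. weighted_contraction w c (\<lambda>r. \<phi> (Z s r)) \<and> H s = \<phi> (Z s (H s))"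
  shows "(H has_derivative L) (at t)"
proof -
  from L obtain Z' where Z': "((\<lambda>(s, r). Z s r) has_derivative Z') (at (t, H t))"
    and L': "bounded_linear L" "\<And>h. L h = diag \<delta> *v Z' (h, L h)"
    unfolding implicit_derivative_def x by blast
  have "((\<lambda>p. \<phi> ((\<lambda>(s, r). Z s r) p)) has_derivative (\<lambda>h. diag \<delta> *v Z' h)) (at (t, H t))"
    using has_derivative_compose[OF Z', of \<phi>] \<phi> by (simp add: x)
  then have "((\<lambda>(s, r). \<phi> (Z s r)) has_derivative (\<lambda>h. diag \<delta> *v Z' h)) (at (t, H t))"
    by (simp add: case_prod_unfold)
  from fixed_point_has_derivative[OF c w F this L'] show ?thesis .
qed

lemma implicit_output_derivative_imp_has_derivative:
  assumes M: "implicit_output_derivative \<delta> Z R t x M"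
    and c: "c < 1" and w: "\<And>i. 1 \<le> w $ i"
    and x: "H t = x"
    and \<phi>: "(\<phi> has_derivative (*v) (diag \<delta>)) (at (Z t x))"
    and F: "\<forall>\<^sub>F s in nhds t. weighted_contraction w c (\<lambda>r. \<phi> (Z s r)) \<and> H s = \<phi> (Z s (H s))"
  shows "((\<lambda>s. R s (H s)) has_derivative M) (at t)"
proof -
  from M obtain L R' where L: "implicit_derivative \<delta> Z t x L"
    and R': "((\<lambda>(s, r). R s r) has_derivative R') (at (t, H t))"
    and M': "\<And>h. M h = R' (h, L h)"
    unfolding implicit_output_derivative_def x by blast
  have "(H has_derivative L) (at t)"
    by (rule implicit_derivative_imp_has_derivative[OF L c w x \<phi> F])
  then have "((\<lambda>s. (\<lambda>(s, r). R s r) (s, H s)) has_derivative (\<lambda>h. R' (h, L h))) (at t)"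
    using R' by (intro has_derivative_compose[OF has_derivative_Pair[OF has_derivative_ident]])
  moreover have "M = (\<lambda>h. R' (h, L h))"
    using M' by blast
  ultimately show ?thesis by simp
qed

lemma implicit_gradient_imp_GDERIV:
  assumes G: "implicit_gradient \<delta> Z R \<l> t x G"
    and c: "c < 1" and w: "\<And>i. 1 \<le> w $ i"
    and x: "H t = x"
    and \<phi>: "(\<phi> has_derivative (*v) (diag \<delta>)) (at (Z t x))"
    and F: "\<forall>\<^sub>F s in nhds t. weighted_contraction w c (\<lambda>r. \<phi> (Z s r)) \<and> H s = \<phi> (Z s (H s))"
  shows "GDERIV (\<lambda>s. \<l> (R s (H s))) t :> G"
proof -
  from G obtain M \<l>' where M: "implicit_output_derivative \<delta> Z R t x M"
    and \<l>': "(\<l> has_derivative \<l>') (at (R t (H t)))"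
    and eq: "\<And>h. \<l>' (M h) = h \<bullet> G"
    unfolding implicit_gradient_def x by blast
  have "((\<lambda>s. R s (H s)) has_derivative M) (at t)"
    by (rule implicit_output_derivative_imp_has_derivative[OF M c w x \<phi> F])
  from has_derivative_compose[OF this \<l>'] show ?thesis
    by (simp add: gderiv_def eq)
qed

section \<open>Matrix calculus and derivatives of the activation\<close>

lemma diag_mult_vector_nth [simp]: "(diag \<delta> *v x) $ i = \<delta> $ i * x $ i"
  by (simp add: diag_def matrix_vector_mult_def if_distrib[where f="\<lambda>c. c * _"] sum.delta
      cong: if_cong)

lemma transpose_diag [simp]: "transpose (diag \<delta>) = diag \<delta>"
  by (auto simp: diag_def transpose_def vec_eq_iff)

lemma inner_diag_commute: "(diag \<delta> *v x) \<bullet> z = x \<bullet> (diag \<delta> *v z)"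
  by (simp add: inner_vec_def mult_ac)

text \<open>The inner product on matrices is the Frobenius one, so this identifies the gradient of a
  functional \<open>h \<mapsto> v \<bullet> (h *v x)\<close> of a matrix \<open>h\<close>.\<close>

lemma inner_outer: "outer v x \<bullet> A = v \<bullet> (A *v x)"
  by (simp add: inner_vec_def outer_def matrix_vector_mult_def sum_distrib_left mult_ac)

text \<open>Supplies the product rule for the cases in which the matrix itself is the
  parameter.\<close>

lemma bounded_bilinear_matrix_vector_mult:
  "bounded_bilinear ((*v) :: real^'n^'m \<Rightarrow> real^'n \<Rightarrow> real^'m)"
  unfolding bilinear_conv_bounded_bilinear[symmetric] bilinear_def
  by (intro conjI allI linearI)
    (simp_all add: matrix_vector_mult_add_rdistrib matrix_vector_right_distrib
      matrix_vector_mult_scaleR flip: scaleR_matrix_vector_assoc)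

lemmas has_derivative_matrix_vector_mult [derivative_intros] =
  bounded_bilinear.FDERIV[OF bounded_bilinear_matrix_vector_mult]

lemma componentwise_has_derivative_diag:
  assumes "\<And>r i. \<phi> r $ i = \<phi>c i (r $ i)"
    and "\<And>i. (\<phi>c i has_real_derivative \<delta> $ i) (at (x $ i))"
  shows "(\<phi> has_derivative (*v) (diag \<delta>)) (at x)"
proof -
  have "((\<lambda>r. \<phi>c i (r $ i)) has_derivative (\<lambda>h. h $ i * \<delta> $ i)) (at x)" for i
    using assms(2)[of i]
    by (intro DERIV_compose_FDERIV[where f="\<phi>c i"] bounded_linear_imp_has_derivative
        bounded_linear_vec_nth)
  then show ?thesis
    unfolding has_derivative_componentwise_within[of \<phi>]
    by (simp add: Basis_vec_def inner_axis assms(1) mult.commute)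
qed

text \<open>The one-sided difference quotients are 1 and 0. This rules out the kink alternative for
  \<open>\<delta>\<close> when every \<open>\<phi>c i\<close> is differentiable at its
  argument.\<close>

lemma not_differentiable_relu: "\<not> (\<lambda>r. max 0 r :: real) differentiable (at 0)"
proof
  assume "(\<lambda>r. max 0 r :: real) differentiable (at 0)"
  then obtain D where D: "((\<lambda>r. max 0 r :: real) has_real_derivative D) (at 0)"
    using real_differentiable_def by blast
  then have "((\<lambda>h. max 0 h / h) \<longlongrightarrow> D) (at (0::real))"
    by (simp add: DERIV_def)
  then have R: "((\<lambda>h. max 0 h / h) \<longlongrightarrow> D) (at_right (0::real))"
    and L: "((\<lambda>h. max 0 h / h) \<longlongrightarrow> D) (at_left (0::real))"
    by (auto simp: filterlim_at_split)
  have "((\<lambda>h. max 0 h / h) \<longlongrightarrow> 1) (at_right (0::real))"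
    by (rule tendsto_eventually) (auto simp: eventually_at_filter)
  moreover have "((\<lambda>h. max 0 h / h) \<longlongrightarrow> 0) (at_left (0::real))"
    by (rule tendsto_eventually) (auto simp: eventually_at_filter)
  ultimately show False
    using tendsto_unique[OF _ R, of 1] tendsto_unique[OF _ L, of 0] by simp
qed

text \<open>All difference quotients have modulus at most 1. The derivative may be negative, hence
  the absolute value.\<close>

lemma nonexpansive_has_real_derivative_le_1:
  fixes f :: "real \<Rightarrow> real"
  assumes "(f has_real_derivative D) (at x)" and "\<And>r s. \<bar>f r - f s\<bar> \<le> \<bar>r - s\<bar>"
  shows "\<bar>D\<bar> \<le> 1"
proof -
  have "((\<lambda>h. \<bar>(f (x + h) - f x) / h\<bar>) \<longlongrightarrow> \<bar>D\<bar>) (at 0)"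
    using assms(1) by (intro tendsto_rabs) (simp add: DERIV_def)
  moreover have "\<bar>(f (x + h) - f x) / h\<bar> \<le> 1" for h
    using assms(2)[of "x + h" x] by (cases "h = 0") (auto simp: abs_divide pos_divide_le_eq)
  ultimately show ?thesis
    by (intro tendsto_upperbound[OF _ always_eventually]) auto
qed

section \<open>Invertibility and the adjoint equation\<close>

lemma matrix_inv_left: "invertible A \<Longrightarrow> matrix_inv A ** A = mat 1"
  and matrix_inv_right: "invertible A \<Longrightarrow> A ** matrix_inv A = mat 1"
  for A :: "'a::semiring_1^'n^'m"
  using someI_ex[of "\<lambda>B. A ** B = mat 1 \<and> B ** A = mat 1"]
  by (simp_all add: invertible_def matrix_inv_def)

text \<open>Differentiation in \<open>W\<close> requires one weight vector and one rate that serve a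
  whole neighbourhood of \<open>W\<close>.\<close>

lemma lambda_pf_less_1_imp_eventually_weights:
  fixes W :: "real^'n^'n"
  assumes "lambda_pf \<bar>W\<bar> < 1"
  obtains w c where "\<And>i. 1 \<le> w $ i" "c < 1"
    "\<forall>\<^sub>F W' in nhds W. \<forall>i. (\<bar>W'\<bar> *v w) $ i \<le> c * w $ i"
proof -
  obtain w where w: "\<And>i. 1 \<le> w $ i" and Ww: "\<And>i. (\<bar>W\<bar> *v w) $ i = w $ i - 1"
    using lambda_pf_less_1_imp_weights[OF assms] by (auto simp: abs_vec_def)
  define S where "S = (\<Sum>i\<in>UNIV. w $ i)"
  have w0: "0 \<le> w $ i" for i using w[of i] by simp
  have wS: "w $ i \<le> S" for i
    unfolding S_def using w0 by (intro member_le_sum) auto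
  have S: "0 < S" using w wS by (metis less_le_trans zero_less_one)
  \<comment> \<open>As \<open>w $ i \<le> S\<close>, one has
    \<open>c * w $ i \<ge> w $ i - 1 / 2\<close>, whereas \<open>|W| w = w - 1\<close>. The gap
    makes the inequality strict at \<open>W\<close>, so continuity carries it to nearby
    matrices.\<close>
  define c where "c = 1 - 1 / (2 * S)"
  have "c < 1" using S by (simp add: c_def)
  have lt: "\<forall>\<^sub>F W' in nhds W. (\<bar>W'\<bar> *v w) $ i < c * w $ i" for i
  proof (rule order_tendstoD)
    show "((\<lambda>W'. (\<bar>W'\<bar> *v w) $ i) \<longlongrightarrow> (\<bar>W\<bar> *v w) $ i) (nhds W)"
      by (auto simp: matrix_vector_mult_def abs_vec_def intro!: tendsto_intros filterlim_ident)
    have "w $ i / (2 * S) \<le> 1 / 2"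
      using S wS[of i] by (simp add: field_simps)
    then show "(\<bar>W\<bar> *v w) $ i < c * w $ i"
      by (simp add: Ww c_def left_diff_distrib)
  qed
  have "\<forall>\<^sub>F W' in nhds W. \<forall>i. (\<bar>W'\<bar> *v w) $ i \<le> c * w $ i"
    by (rule eventually_all_finite) (rule eventually_mono[OF lt less_imp_le])
  with w \<open>c < 1\<close> show thesis by (rule that)
qed

text \<open>A kernel vector is a fixed point of the contraction
  \<open>x \<mapsto> diag \<delta> *v (W *v x)\<close>, and so is 0.\<close>

lemma invertible_mat_1_minus_diag_mult:
  fixes W :: "real^'n^'n"
  assumes c: "c < 1" and w: "\<And>i. 1 \<le> w $ i"
    and W: "\<And>i. (\<bar>W\<bar> *v w) $ i \<le> c * w $ i"
    and \<delta>: "\<And>i. \<bar>\<delta> $ i\<bar> \<le> 1"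
  shows "invertible (mat 1 - diag \<delta> ** W)"
  unfolding invertible_left_inverse matrix_left_invertible_ker
proof (intro allI impI)
  fix x assume "(mat 1 - diag \<delta> ** W) *v x = 0"
  then have "x = diag \<delta> *v (W *v x + 0)"
    by (simp add: matrix_vector_mult_diff_rdistrib matrix_vector_mul_assoc)
  moreover have "weighted_contraction w c (\<lambda>x. diag \<delta> *v (W *v x + 0))"
  proof (rule weighted_contraction_nonexpansive_affine[OF _ W])
    fix r s :: "real^'n"
    have "\<bar>\<delta> $ i\<bar> * \<bar>r $ i - s $ i\<bar> \<le> \<bar>r $ i - s $ i\<bar>" for i
      using mult_right_mono[OF \<delta>, of "\<bar>r $ i - s $ i\<bar>" i] by simp
    then show "\<bar>diag \<delta> *v r - diag \<delta> *v s\<bar> \<le> \<bar>r - s\<bar>"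
      by (simp add: less_eq_vec_def abs_vec_def abs_mult flip: right_diff_distrib)
    show "0 < w $ i" for i using w[of i] by simp
  qed
  then have "\<exists>!x. x = diag \<delta> *v (W *v x + 0)"
    using c w by (rule weighted_contraction_ex1_fixed_point)
  ultimately show "x = 0"
    by (metis add.right_neutral matrix_vector_mult_0_right)
qed

text \<open>Both sides amount to \<open>(I - D A) x = D a\<close>. It is applied with
  \<open>A = W\<close> to the sensitivities and with the transpose of \<open>W\<close> to the
  adjoint equation.\<close>

lemma linear_fixed_point_iff:
  fixes A D :: "real^'n^'n"
  assumes "invertible (mat 1 - D ** A)"
  shows "x = D *v (a + A *v x) \<longleftrightarrow> x = (matrix_inv (mat 1 - D ** A) ** D) *v a"
proof -
  let ?T = "mat 1 - D ** A"
  have "x = D *v (a + A *v x) \<longleftrightarrow> ?T *v x = D *v a"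
    by (simp add: matrix_vector_mult_diff_rdistrib matrix_vector_right_distrib diff_eq_eq
        flip: matrix_vector_mul_assoc)
  also have "\<dots> \<longleftrightarrow> x = matrix_inv ?T *v (D *v a)"
    by (metis assms matrix_inv_left matrix_inv_right matrix_vector_mul_assoc matrix_vector_mul_lid)
  finally show ?thesis
    by (simp add: matrix_vector_mul_assoc)
qed

text \<open>Transposing \<open>I - D W\<close> gives \<open>I - W^T D\<close>, with the factors in
  the other order. A kernel vector \<open>v = D W^T v\<close> is therefore replaced by
  \<open>z = W^T v\<close>, which satisfies \<open>z = W^T D z\<close>; thus \<open>z = 0\<close>
  and \<open>v = D z = 0\<close>.\<close>

lemma invertible_mat_1_minus_diag_mult_transpose:
  fixes W :: "real^'n^'n"
  assumes "invertible (mat 1 - diag \<delta> ** W)"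
  shows "invertible (mat 1 - diag \<delta> ** transpose W)"
  unfolding invertible_left_inverse matrix_left_invertible_ker
proof (intro allI impI)
  fix v assume "(mat 1 - diag \<delta> ** transpose W) *v v = 0"
  then have v: "v = diag \<delta> *v (transpose W *v v)"
    by (simp add: matrix_vector_mult_diff_rdistrib flip: matrix_vector_mul_assoc)
  define z where "z = transpose W *v v"
  have "z = transpose W *v (diag \<delta> *v z)"
    unfolding z_def using v by simp
  then have "(mat 1 - transpose W ** diag \<delta>) *v z = 0"
    by (simp add: matrix_vector_mult_diff_rdistrib flip: matrix_vector_mul_assoc)
  moreover have "mat 1 - transpose W ** diag \<delta> = transpose (mat 1 - diag \<delta> ** W)"
  proof -
    have "transpose (mat 1 - diag \<delta> ** W) = transpose (mat 1) - transpose (diag \<delta> ** W)"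
      by (simp add: transpose_def vec_eq_iff)
    then show ?thesis
      by (simp add: matrix_transpose_mul transpose_mat)
  qed
  moreover have "invertible (transpose (mat 1 - diag \<delta> ** W))"
    using assms by (rule transpose_invertible)
  ultimately have "z = 0"
    unfolding invertible_left_inverse matrix_left_invertible_ker by metis
  then show "v = 0"
    using v by (simp add: z_def)
qed

lemma adjoint_ex1:
  fixes W :: "real^'n^'n"
  assumes "invertible (mat 1 - diag \<delta> ** W)"
  shows "\<exists>!v. v = diag \<delta> *v (transpose W *v v + a)"
  unfolding add.commute[of _ a]
    linear_fixed_point_iff[OF invertible_mat_1_minus_diag_mult_transpose[OF assms]]
  by blast

text \<open>Evaluate \<open>(W^T v + g) \<bullet> k\<close> after inserting the equation for
  \<open>k\<close>, moving the symmetric \<open>diag \<delta>\<close> to the other side; the two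
  terms containing \<open>W\<close> cancel.\<close>

lemma inner_adjoint_eq:
  fixes W :: "real^'n^'n"
  assumes v: "v = diag \<delta> *v (transpose W *v v + g)" and k: "k = diag \<delta> *v (a + W *v k)"
  shows "g \<bullet> k = v \<bullet> a"
proof -
  have "(transpose W *v v) \<bullet> k + g \<bullet> k = (transpose W *v v + g) \<bullet> (diag \<delta> *v (a + W *v k))"
    by (simp only: inner_add_left k[symmetric])
  also have "\<dots> = (diag \<delta> *v (transpose W *v v + g)) \<bullet> (a + W *v k)"
    by (simp only: inner_diag_commute)
  also have "\<dots> = v \<bullet> a + v \<bullet> (W *v k)"
    by (simp only: v[symmetric] inner_add_right)
  finally show ?thesis
    by (simp add: dot_lmul_matrix)
qed

section \<open>Sensitivities and gradients in closed form\<close>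

context
  fixes W :: "real^'q^'q" and \<delta> :: "real^'q"
    and Z :: "'a::real_normed_vector \<Rightarrow> real^'q \<Rightarrow> real^'q" and A :: "'a \<Rightarrow> real^'q"
    and t :: 'a and x :: "real^'q"
  assumes inv: "invertible (mat 1 - diag \<delta> ** W)"
    and Z: "((\<lambda>(s, r). Z s r) has_derivative (\<lambda>(h, k). A h + W *v k)) (at (t, x))"
begin

text \<open>Uniqueness of the derivative of \<open>Z\<close> removes the existential quantifier, and
  what remains is a linear fixed-point equation for \<open>L h\<close> with source
  \<open>A h\<close>. The map \<open>A\<close> records how the parameter enters:
  \<open>U *v h\<close> for \<open>y\<close>, \<open>h *v \<eta>\<close> for \<open>W\<close>, 0 for
  a parameter of the output alone.\<close>

lemma implicit_derivative_iff:
  "implicit_derivative \<delta> Z t x L \<longleftrightarrow>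
     L = (\<lambda>h. (matrix_inv (mat 1 - diag \<delta> ** W) ** diag \<delta>) *v A h)"
proof -
  have "bounded_linear (\<lambda>(h, k). A h + W *v k)"
    using Z by (rule has_derivative_bounded_linear)
  \<comment> \<open>Restricting the derivative to \<open>k = 0\<close> isolates \<open>A\<close>;
    its boundedness makes the closed form for \<open>L\<close> bounded linear.\<close>
  then have "bounded_linear (\<lambda>h. (\<lambda>(h, k). A h + W *v k) (h, 0))"
    by (rule bounded_linear_compose) (intro bounded_linear_intros)
  then have A: "bounded_linear A"
    by simp
  have "implicit_derivative \<delta> Z t x L \<longleftrightarrow>
      bounded_linear L \<and> (\<forall>h. L h = diag \<delta> *v (A h + W *v L h))"
    unfolding implicit_derivative_def using Z has_derivative_unique[OF Z] by fastforce
  also have "\<dots> \<longleftrightarrow> bounded_linear L \<and>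
      L = (\<lambda>h. (matrix_inv (mat 1 - diag \<delta> ** W) ** diag \<delta>) *v A h)"
    by (simp only: linear_fixed_point_iff[OF inv] fun_eq_iff)
  also have "\<dots> \<longleftrightarrow> L = (\<lambda>h. (matrix_inv (mat 1 - diag \<delta> ** W) ** diag \<delta>) *v A h)"
    using bounded_linear_compose[OF matrix_vector_mul_bounded_linear A] by blast
  finally show ?thesis .
qed

lemma implicit_output_derivative_iff:
  assumes R: "((\<lambda>(s, r). R s r) has_derivative (\<lambda>(h, k). B h + V *v k)) (at (t, x))"
  shows "implicit_output_derivative \<delta> Z R t x M \<longleftrightarrow>
     M = (\<lambda>h. B h + V *v ((matrix_inv (mat 1 - diag \<delta> ** W) ** diag \<delta>) *v A h))"
proof -
  have "((\<lambda>(s, r). R s r) has_derivative R') (at (t, x)) \<longleftrightarrow> R' = (\<lambda>(h, k). B h + V *v k)" for R'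
    using R has_derivative_unique[OF R] by blast
  then show ?thesis
    unfolding implicit_output_derivative_def implicit_derivative_iff by auto
qed

end

text \<open>For the sensitivity \<open>k\<close> in direction \<open>h\<close>, the adjoint identity
  turns \<open>g \<bullet> (B h + V *v k)\<close> into
  \<open>g \<bullet> B h + v \<bullet> A h\<close>. The condition on \<open>G\<^sub>0\<close> thus
  contains no inverse matrix, and a vector is determined by its inner products with all
  \<open>h\<close>.\<close>

lemma implicit_gradient_iff:
  fixes W :: "real^'q^'q" and Z :: "'a::real_inner \<Rightarrow> real^'q \<Rightarrow> real^'q"
  assumes inv: "invertible (mat 1 - diag \<delta> ** W)"
    and Z: "((\<lambda>(s, r). Z s r) has_derivative (\<lambda>(h, k). A h + W *v k)) (at (t, x))"
    and R: "((\<lambda>(s, r). R s r) has_derivative (\<lambda>(h, k). B h + V *v k)) (at (t, x))"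
    and \<l>: "GDERIV \<l> (R t x) :> g"
    and v: "v = diag \<delta> *v (transpose W *v v + transpose V *v g)"
    and G\<^sub>0: "\<And>h. g \<bullet> B h + v \<bullet> A h = G\<^sub>0 \<bullet> h"
  shows "implicit_gradient \<delta> Z R \<l> t x G \<longleftrightarrow> G = G\<^sub>0"
proof -
  define N where "N = matrix_inv (mat 1 - diag \<delta> ** W) ** diag \<delta>"
  have "(B h + V *v (N *v A h)) \<bullet> g = h \<bullet> G\<^sub>0" for h
  proof -
    have "N *v A h = diag \<delta> *v (A h + W *v (N *v A h))"
      using linear_fixed_point_iff[OF inv] by (simp add: N_def)
    then have "(transpose V *v g) \<bullet> (N *v A h) = v \<bullet> A h"
      by (rule inner_adjoint_eq[OF v])
    then have "g \<bullet> (V *v (N *v A h)) = v \<bullet> A h"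
      by (simp add: dot_lmul_matrix)
    then show ?thesis
      using G\<^sub>0[of h] by (simp add: inner_add_right inner_commute[of _ g] inner_commute[of h])
  qed
  moreover have "implicit_gradient \<delta> Z R \<l> t x G \<longleftrightarrow>
      (\<forall>h. (B h + V *v (N *v A h)) \<bullet> g = h \<bullet> G)"
    unfolding implicit_gradient_def implicit_output_derivative_iff[OF inv Z R] N_def
    using \<l> has_derivative_unique[OF \<l>[unfolded gderiv_def]] unfolding gderiv_def by fastforce
  ultimately show ?thesis
    by (auto simp: vector_eq_rdot[of G G\<^sub>0, symmetric] inner_commute)
qed

section \<open>The equilibrium map and the assembled statement\<close>

lemma equilibrium_fixed_point:
  assumes "\<exists>!x. x = \<phi> (W *v x + U *v y + b)"
  shows "equilibrium \<phi> W U b y = \<phi> (W *v equilibrium \<phi> W U b y + U *v y + b)"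
  unfolding equilibrium_def by (rule theI'[OF assms])

text \<open>The equivalences assert existence and uniqueness of the generalized sensitivities, at
  kinks as well; under \<open>differentiable_case\<close> the same formulas are genuine derivatives
  of \<open>equilibrium\<close> and \<open>control\<close>.\<close>

theorem proposition2:
  fixes \<phi> :: "real^'q \<Rightarrow> real^'q" and \<phi>c :: "'q \<Rightarrow> real \<Rightarrow> real"
    and W :: "real^'q^'q" and U :: "real^'p^'q" and V :: "real^'q^'m" and K :: "real^'p^'m"
    and b :: "real^'q" and d :: "real^'m" and y :: "real^'p"
    and \<eta> \<delta> :: "real^'q" and u :: "real^'m"
  assumes componentwise: "\<And>r i. \<phi> r $ i = \<phi>c i (r $ i)"
    and nonexpansive: "\<And>r s. \<bar>\<phi> r - \<phi> s\<bar> \<le> \<bar>r - s\<bar>"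
    and pf: "lambda_pf \<bar>W\<bar> < 1"
    and \<eta>: "\<eta> = \<phi> (W *v \<eta> + U *v y + b)"
    and u: "u = K *v y + V *v \<eta> + d"
    and \<delta>: "\<And>i. (\<phi>c i has_real_derivative \<delta> $ i) (at ((W *v \<eta> + U *v y + b) $ i)) \<or>
               (\<phi>c i = (\<lambda>r. max 0 r) \<and> (W *v \<eta> + U *v y + b) $ i = 0 \<and> \<delta> $ i \<in> {0..1})"
  shows
    "(\<forall>\<^sub>F W' in nhds W. \<forall>(U' :: real^'p^'q) b' y'. \<exists>!x. x = \<phi> (W' *v x + U' *v y' + b')) \<and>
     invertible (mat 1 - diag \<delta> ** W) \<and>
     (let J = matrix_inv (mat 1 - diag \<delta> ** W) ** diag \<delta> ** U;
          differentiable_case = (\<forall>i. \<phi>c i differentiable (at ((W *v \<eta> + U *v y + b) $ i)))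
      in
       (\<forall>A. implicit_derivative \<delta> (\<lambda>y x. W *v x + U *v y + b) y \<eta> ((*v) A) \<longleftrightarrow> A = J) \<and>
       (\<forall>A. implicit_output_derivative \<delta> (\<lambda>y x. W *v x + U *v y + b)
              (\<lambda>y x. K *v y + V *v x + d) y \<eta> ((*v) A) \<longleftrightarrow> A = K + V ** J) \<and>
       (differentiable_case \<longrightarrow>
          ((\<lambda>y. equilibrium \<phi> W U b y) has_derivative (*v) J) (at y) \<and>
          ((\<lambda>y. control \<phi> W U V K b d y) has_derivative (*v) (K + V ** J)) (at y)) \<and>
       (\<forall>\<l> g. GDERIV \<l> u :> g \<longrightarrow>
          (\<exists>!v. v = diag \<delta> *v (transpose W *v v + transpose V *v g)) \<and>
          (\<forall>v. v = diag \<delta> *v (transpose W *v v + transpose V *v g) \<longrightarrow>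
             (\<forall>G. implicit_gradient \<delta> (\<lambda>y x. W *v x + U *v y + b) (\<lambda>y x. K *v y + V *v x + d) \<l> y \<eta> G
                    \<longleftrightarrow> G = transpose K *v g + transpose U *v v) \<and>
             (\<forall>G. implicit_gradient \<delta> (\<lambda>W x. W *v x + U *v y + b) (\<lambda>W x. K *v y + V *v x + d) \<l> W \<eta> G
                    \<longleftrightarrow> G = outer v \<eta>) \<and>
             (\<forall>G. implicit_gradient \<delta> (\<lambda>U x. W *v x + U *v y + b) (\<lambda>U x. K *v y + V *v x + d) \<l> U \<eta> G
                    \<longleftrightarrow> G = outer v y) \<and>
             (\<forall>G. implicit_gradient \<delta> (\<lambda>b x. W *v x + U *v y + b) (\<lambda>b x. K *v y + V *v x + d) \<l> b \<eta> G
                    \<longleftrightarrow> G = v) \<and>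
             (\<forall>G. implicit_gradient \<delta> (\<lambda>V x. W *v x + U *v y + b) (\<lambda>V x. K *v y + V *v x + d) \<l> V \<eta> G
                    \<longleftrightarrow> G = outer g \<eta>) \<and>
             (\<forall>G. implicit_gradient \<delta> (\<lambda>K x. W *v x + U *v y + b) (\<lambda>K x. K *v y + V *v x + d) \<l> K \<eta> G
                    \<longleftrightarrow> G = outer g y) \<and>
             (\<forall>G. implicit_gradient \<delta> (\<lambda>d x. W *v x + U *v y + b) (\<lambda>d x. K *v y + V *v x + d) \<l> d \<eta> G
                    \<longleftrightarrow> G = g) \<and>
             (differentiable_case \<longrightarrow>
                GDERIV (\<lambda>y. \<l> (control \<phi> W U V K b d y)) y :> transpose K *v g + transpose U *v v \<and>
                GDERIV (\<lambda>W. \<l> (control \<phi> W U V K b d y)) W :> outer v \<eta> \<and>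
                GDERIV (\<lambda>U. \<l> (control \<phi> W U V K b d y)) U :> outer v y \<and>
                GDERIV (\<lambda>b. \<l> (control \<phi> W U V K b d y)) b :> v \<and>
                GDERIV (\<lambda>V. \<l> (control \<phi> W U V K b d y)) V :> outer g \<eta> \<and>
                GDERIV (\<lambda>K. \<l> (control \<phi> W U V K b d y)) K :> outer g y \<and>
                GDERIV (\<lambda>d. \<l> (control \<phi> W U V K b d y)) d :> g))))"
proof -
  obtain w c where w: "\<And>i. 1 \<le> w $ i" and c: "c < 1"
    and ev: "\<forall>\<^sub>F W' in nhds W. \<forall>i. (\<bar>W'\<bar> *v w) $ i \<le> c * w $ i"
    using lambda_pf_less_1_imp_eventually_weights[OF pf] by blast
  have w0: "0 < w $ i" for i
    using w[of i] by simp
  have W: "(\<bar>W\<bar> *v w) $ i \<le> c * w $ i" for i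
    using eventually_nhds_x_imp_x[OF ev] by blast
  have contraction: "weighted_contraction w c (\<lambda>r. \<phi> (W' *v r + U' *v y' + b'))"
    if "\<forall>i. (\<bar>W'\<bar> *v w) $ i \<le> c * w $ i" for W' and U' :: "real^'p^'q" and y' b'
    using weighted_contraction_nonexpansive_affine[OF nonexpansive _ w0, of W' c "U' *v y' + b'"]
      that by (simp add: add.assoc)
  have ex1: "\<exists>!x. x = \<phi> (W' *v x + U' *v y' + b')"
    if "\<forall>i. (\<bar>W'\<bar> *v w) $ i \<le> c * w $ i" for W' and U' :: "real^'p^'q" and y' b'
    by (rule weighted_contraction_ex1_fixed_point[OF contraction[OF that] c w])
  have fixed: "weighted_contraction w c (\<lambda>r. \<phi> (W' *v r + U' *v y' + b')) \<and>
      equilibrium \<phi> W' U' b' y' = \<phi> (W' *v equilibrium \<phi> W' U' b' y' + U' *v y' + b')"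
    if "\<forall>i. (\<bar>W'\<bar> *v w) $ i \<le> c * w $ i" for W' and U' :: "real^'p^'q" and y' b'
    using contraction[OF that] equilibrium_fixed_point[OF ex1[OF that]] by blast
  have eq_\<eta>: "equilibrium \<phi> W U b y = \<eta>"
    using ex1[of W U y b] W \<eta> unfolding equilibrium_def by (intro the1_equality) auto

  have "\<bar>\<delta> $ i\<bar> \<le> 1" for i
    using \<delta>[of i]
  proof
    assume "(\<phi>c i has_real_derivative \<delta> $ i) (at ((W *v \<eta> + U *v y + b) $ i))"
    \<comment> \<open>Constant vectors extract the scalar estimate from the vector one.\<close>
    moreover have "\<bar>\<phi>c i r - \<phi>c i s\<bar> \<le> \<bar>r - s\<bar>" for r s
      using nonexpansive[of "\<chi> i. r" "\<chi> i. s"]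
      by (auto simp: less_eq_vec_def abs_vec_def componentwise)
    ultimately show ?thesis
      by (rule nonexpansive_has_real_derivative_le_1)
  qed auto
  with c w W have inv: "invertible (mat 1 - diag \<delta> ** W)"
    by (rule invertible_mat_1_minus_diag_mult)

  have \<phi>_deriv: "(\<phi> has_derivative (*v) (diag \<delta>)) (at (W *v \<eta> + U *v y + b))"
    if "\<forall>i. \<phi>c i differentiable (at ((W *v \<eta> + U *v y + b) $ i))"
  proof (rule componentwise_has_derivative_diag[of \<phi> \<phi>c], rule componentwise)
    show "(\<phi>c i has_real_derivative \<delta> $ i) (at ((W *v \<eta> + U *v y + b) $ i))" for i
      using \<delta>[of i] that not_differentiable_relu by metis
  qed

  define J where "J = matrix_inv (mat 1 - diag \<delta> ** W) ** diag \<delta> ** U"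

  \<comment> \<open>All derivatives are brought to the shape \<open>A h + W *v k\<close> or
    \<open>B h + V *v k\<close>; a parameter that is absent from the map in question contributes the
    explicit summand 0.\<close>
  have Zy: "((\<lambda>(s, r). W *v r + U *v s + b) has_derivative (\<lambda>(h, k). U *v h + W *v k)) (at (y, \<eta>))"
    and ZW: "((\<lambda>(s, r). s *v r + U *v y + b) has_derivative (\<lambda>(h, k). h *v \<eta> + W *v k)) (at (W, \<eta>))"
    and ZU: "((\<lambda>(s, r). W *v r + s *v y + b) has_derivative (\<lambda>(h, k). h *v y + W *v k)) (at (U, \<eta>))"
    and Zb: "((\<lambda>(s, r). W *v r + U *v y + s) has_derivative (\<lambda>(h, k). h + W *v k)) (at (b, \<eta>))"
    and Z_const: "((\<lambda>(s, r). W *v r + U *v y + b) has_derivative (\<lambda>(h, k). 0 + W *v k)) (at (t, \<eta>))"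
    for t :: "'t::real_normed_vector"
    by (auto simp: case_prod_unfold intro!: derivative_eq_intros)
  have Ry: "((\<lambda>(s, r). K *v s + V *v r + d) has_derivative (\<lambda>(h, k). K *v h + V *v k)) (at (y, \<eta>))"
    and RV: "((\<lambda>(s, r). K *v y + s *v r + d) has_derivative (\<lambda>(h, k). h *v \<eta> + V *v k)) (at (V, \<eta>))"
    and RK: "((\<lambda>(s, r). s *v y + V *v r + d) has_derivative (\<lambda>(h, k). h *v y + V *v k)) (at (K, \<eta>))"
    and Rd: "((\<lambda>(s, r). K *v y + V *v r + s) has_derivative (\<lambda>(h, k). h + V *v k)) (at (d, \<eta>))"
    and R_const: "((\<lambda>(s, r). K *v y + V *v r + d) has_derivative (\<lambda>(h, k). 0 + V *v k)) (at (t, \<eta>))"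
    for t :: "'t::real_normed_vector"
    by (auto simp: case_prod_unfold intro!: derivative_eq_intros)

  have J: "implicit_derivative \<delta> (\<lambda>y x. W *v x + U *v y + b) y \<eta> ((*v) A) \<longleftrightarrow> A = J" for A
    unfolding implicit_derivative_iff[OF inv Zy] J_def
    by (simp add: matrix_eq fun_eq_iff matrix_vector_mul_assoc)
  have KVJ: "implicit_output_derivative \<delta> (\<lambda>y x. W *v x + U *v y + b)
      (\<lambda>y x. K *v y + V *v x + d) y \<eta> ((*v) A) \<longleftrightarrow> A = K + V ** J" for A
    unfolding implicit_output_derivative_iff[OF inv Zy Ry] J_def
    by (simp add: matrix_eq fun_eq_iff matrix_vector_mult_add_rdistrib matrix_vector_mul_assoc
        matrix_mul_assoc)

  \<comment> \<open>With \<open>W\<close> held fixed the contraction estimate holds for every value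
    of the parameter. Only variation of \<open>W\<close> is confined to a neighbourhood.\<close>
  have fixed_W: "\<forall>\<^sub>F s in nhds t. weighted_contraction w c (\<lambda>r. \<phi> (W *v r + U' s *v y' s + b' s)) \<and>
      equilibrium \<phi> W (U' s) (b' s) (y' s) =
      \<phi> (W *v equilibrium \<phi> W (U' s) (b' s) (y' s) + U' s *v y' s + b' s)"
    for t :: "'t::topological_space" and U' :: "'t \<Rightarrow> real^'p^'q" and y' b'
    using W by (intro always_eventually allI fixed) blast
  have fixed_nhds_W: "\<forall>\<^sub>F s in nhds W. weighted_contraction w c (\<lambda>r. \<phi> (s *v r + U *v y + b)) \<and>
      equilibrium \<phi> s U b y = \<phi> (s *v equilibrium \<phi> s U b y + U *v y + b)"
    using ev by (rule eventually_mono) (rule fixed)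

  have gradients:
    "\<forall>G. implicit_gradient \<delta> (\<lambda>y x. W *v x + U *v y + b) (\<lambda>y x. K *v y + V *v x + d) \<l> y \<eta> G
            \<longleftrightarrow> G = transpose K *v g + transpose U *v v"
    "\<forall>G. implicit_gradient \<delta> (\<lambda>W x. W *v x + U *v y + b) (\<lambda>W x. K *v y + V *v x + d) \<l> W \<eta> G
            \<longleftrightarrow> G = outer v \<eta>"
    "\<forall>G. implicit_gradient \<delta> (\<lambda>U x. W *v x + U *v y + b) (\<lambda>U x. K *v y + V *v x + d) \<l> U \<eta> G
            \<longleftrightarrow> G = outer v y"
    "\<forall>G. implicit_gradient \<delta> (\<lambda>b x. W *v x + U *v y + b) (\<lambda>b x. K *v y + V *v x + d) \<l> b \<eta> G
            \<longleftrightarrow> G = v"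
    "\<forall>G. implicit_gradient \<delta> (\<lambda>V x. W *v x + U *v y + b) (\<lambda>V x. K *v y + V *v x + d) \<l> V \<eta> G
            \<longleftrightarrow> G = outer g \<eta>"
    "\<forall>G. implicit_gradient \<delta> (\<lambda>K x. W *v x + U *v y + b) (\<lambda>K x. K *v y + V *v x + d) \<l> K \<eta> G
            \<longleftrightarrow> G = outer g y"
    "\<forall>G. implicit_gradient \<delta> (\<lambda>d x. W *v x + U *v y + b) (\<lambda>d x. K *v y + V *v x + d) \<l> d \<eta> G
            \<longleftrightarrow> G = g"
    if g: "GDERIV \<l> u :> g" and v: "v = diag \<delta> *v (transpose W *v v + transpose V *v g)" for \<l> g v
    \<comment> \<open>In each case the essential goal is the identity
      \<open>g \<bullet> B h + v \<bullet> A h = G\<^sub>0 \<bullet> h\<close>, settled by moving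
      transposes and by \<open>inner_outer\<close>.\<close>
    subgoal using g unfolding u by (intro allI implicit_gradient_iff[OF inv Zy Ry _ v])
        (simp_all add: inner_outer inner_add_left dot_lmul_matrix)
    subgoal using g unfolding u by (intro allI implicit_gradient_iff[OF inv ZW R_const _ v])
        (simp_all add: inner_outer inner_add_left dot_lmul_matrix)
    subgoal using g unfolding u by (intro allI implicit_gradient_iff[OF inv ZU R_const _ v])
        (simp_all add: inner_outer inner_add_left dot_lmul_matrix)
    subgoal using g unfolding u by (intro allI implicit_gradient_iff[OF inv Zb R_const _ v])
        (simp_all add: inner_outer inner_add_left dot_lmul_matrix)
    subgoal using g unfolding u by (intro allI implicit_gradient_iff[OF inv Z_const RV _ v])
        (simp_all add: inner_outer inner_add_left dot_lmul_matrix)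
    subgoal using g unfolding u by (intro allI implicit_gradient_iff[OF inv Z_const RK _ v])
        (simp_all add: inner_outer inner_add_left dot_lmul_matrix)
    subgoal using g unfolding u by (intro allI implicit_gradient_iff[OF inv Z_const Rd _ v])
        (simp_all add: inner_outer inner_add_left dot_lmul_matrix)
    done

  have GDERIVs:
    "GDERIV (\<lambda>y. \<l> (control \<phi> W U V K b d y)) y :> transpose K *v g + transpose U *v v"
    "GDERIV (\<lambda>W. \<l> (control \<phi> W U V K b d y)) W :> outer v \<eta>"
    "GDERIV (\<lambda>U. \<l> (control \<phi> W U V K b d y)) U :> outer v y"
    "GDERIV (\<lambda>b. \<l> (control \<phi> W U V K b d y)) b :> v"
    "GDERIV (\<lambda>V. \<l> (control \<phi> W U V K b d y)) V :> outer g \<eta>"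
    "GDERIV (\<lambda>K. \<l> (control \<phi> W U V K b d y)) K :> outer g y"
    "GDERIV (\<lambda>d. \<l> (control \<phi> W U V K b d y)) d :> g"
    if g: "GDERIV \<l> u :> g" and v: "v = diag \<delta> *v (transpose W *v v + transpose V *v g)"
      and diff: "\<forall>i. \<phi>c i differentiable (at ((W *v \<eta> + U *v y + b) $ i))"
    for \<l> g v
    unfolding control_def
    \<comment> \<open>Reading the equivalence backwards at the closed form yields an implicit
      gradient, which differentiability of the activation then makes a true one.\<close>
    subgoal by (rule implicit_gradient_imp_GDERIV[OF gradients(1)[OF g v, THEN spec, THEN iffD2, OF refl] c w])
        (rule eq_\<eta> \<phi>_deriv[OF diff] fixed_W)+
    subgoal by (rule implicit_gradient_imp_GDERIV[OF gradients(2)[OF g v, THEN spec, THEN iffD2, OF refl] c w])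
        (rule eq_\<eta> \<phi>_deriv[OF diff] fixed_nhds_W)+
    subgoal by (rule implicit_gradient_imp_GDERIV[OF gradients(3)[OF g v, THEN spec, THEN iffD2, OF refl] c w])
        (rule eq_\<eta> \<phi>_deriv[OF diff] fixed_W)+
    subgoal by (rule implicit_gradient_imp_GDERIV[OF gradients(4)[OF g v, THEN spec, THEN iffD2, OF refl] c w])
        (rule eq_\<eta> \<phi>_deriv[OF diff] fixed_W)+
    subgoal by (rule implicit_gradient_imp_GDERIV[OF gradients(5)[OF g v, THEN spec, THEN iffD2, OF refl] c w])
        (rule eq_\<eta> \<phi>_deriv[OF diff] fixed_W)+
    subgoal by (rule implicit_gradient_imp_GDERIV[OF gradients(6)[OF g v, THEN spec, THEN iffD2, OF refl] c w])
        (rule eq_\<eta> \<phi>_deriv[OF diff] fixed_W)+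
    subgoal by (rule implicit_gradient_imp_GDERIV[OF gradients(7)[OF g v, THEN spec, THEN iffD2, OF refl] c w])
        (rule eq_\<eta> \<phi>_deriv[OF diff] fixed_W)+
    done

  have derivs:
    "((\<lambda>y. equilibrium \<phi> W U b y) has_derivative (*v) J) (at y)"
    "((\<lambda>y. control \<phi> W U V K b d y) has_derivative (*v) (K + V ** J)) (at y)"
    if diff: "\<forall>i. \<phi>c i differentiable (at ((W *v \<eta> + U *v y + b) $ i))"
    unfolding control_def
    subgoal by (rule implicit_derivative_imp_has_derivative[OF J[THEN iffD2, OF refl] c w])
        (rule eq_\<eta> \<phi>_deriv[OF diff] fixed_W)+
    subgoal by (rule implicit_output_derivative_imp_has_derivative[OF KVJ[THEN iffD2, OF refl] c w])
        (rule eq_\<eta> \<phi>_deriv[OF diff] fixed_W)+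
    done

  have ex1_nhds:
    "\<forall>\<^sub>F W' in nhds W. \<forall>(U' :: real^'p^'q) b' y'. \<exists>!x. x = \<phi> (W' *v x + U' *v y' + b')"
    using ev by (rule eventually_mono) (intro allI, rule ex1)
  show ?thesis
    unfolding Let_def J_def[symmetric]
    by (intro conjI allI impI ex1_nhds inv J KVJ adjoint_ex1[OF inv])
      (fact derivs gradients[THEN spec] GDERIVs)+
qed

end
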